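(* Let $0<k\le 1$ and let $r(z)=p(z)/w(z) \in \mathcal{R}_n=\mathcal{R}_n(a_1,\dots,a_n)$, where $|a_j|>1$ for $1\le j\le n$, $p$ is a polynomial of degree $n$, and all zeros of $p$ lie in $\{z\in\mathbb{C}: |z|\le k\}$. Let $m=\min_{|z|=k}|r(z)|$. Then for every $z\in\mathbb{C}$ with $|z|=1$, $$|r'(z)| \geq \frac{1}{2}\left[ |B'(z)| + \frac{n(1-k)}{1+k}\right](|r(z)|+m).$$ Moreover, equality holds for $r(z) = \left(\dfrac{z+k}{z-a}\right)^n$ and $B(z) = \left(\dfrac{1-az}{z-a}\right)^n$ (i.e. $a_1=\dots=a_n=a$) evaluated at $z=1$, where $a>1$, $k\le 1$.
   Context: For complex numbers $a_1,\dots,a_n$ (not necessarily distinct) with $|a_j|>1$ for all $j$, put $w(z)=\prod_{j=1}^n (z-a_j)$ and $B(z)=\prod_{j=1}^n \dfrac{1-\overline{a_j}z}{z-a_j}$. Let $\mathcal{P}_n$ be the set of complex polynomials of degree at most $n$, and $\mathcal{R}_n=\mathcal{R}_n(a_1,\dots,a_n)=\{p(z)/w(z) : p\in\mathcal{P}_n\}$. *)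

theory Defs
  imports "HOL-Complex_Analysis.Complex_Analysis"
begin

text \<open>
  The points \<open>a\<^sub>1, \<dots>, a\<^sub>n\<close> (not necessarily distinct) are the values of \<open>a :: nat \<Rightarrow> complex\<close>
  on \<open>{1..n}\<close>; values outside this range are irrelevant. Functions with poles are total
  functions taking the value \<open>0\<close> at the poles (division by zero), all of which lie outside the
  closed unit disc whenever \<open>norm (a j) > 1\<close> for all \<open>j\<close>.
\<close>

definition pole_prod :: "(nat \<Rightarrow> complex) \<Rightarrow> nat \<Rightarrow> complex \<Rightarrow> complex" where
  "pole_prod a n z = (\<Prod>j=1..n. z - a j)"

definition blaschke :: "(nat \<Rightarrow> complex) \<Rightarrow> nat \<Rightarrow> complex \<Rightarrow> complex" where
  "blaschke a n z = (\<Prod>j=1..n. (1 - cnj (a j) * z) / (z - a j))"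

definition rational_space :: "(nat \<Rightarrow> complex) \<Rightarrow> nat \<Rightarrow> (complex \<Rightarrow> complex) set" where
  "rational_space a n = {(\<lambda>z. poly p z / pole_prod a n z) | p. degree p \<le> n}"

text \<open>
  The minimum of \<open>\<bar>f\<bar>\<close> on the circle of radius \<open>k\<close>, as the least element of the set of values;
  it exists for continuous \<open>f\<close> by compactness (lemma below).
\<close>

definition min_modulus :: "(complex \<Rightarrow> complex) \<Rightarrow> real \<Rightarrow> real" where
  "min_modulus f k = (LEAST m. m \<in> (\<lambda>z. norm (f z)) ` sphere 0 k)"

lemma min_modulus_attained:
  assumes "continuous_on (sphere 0 k) f" "0 \<le> k"
  shows "\<exists>z\<in>sphere 0 k. min_modulus f k = norm (f z) \<and> (\<forall>y\<in>sphere 0 k. norm (f z) \<le> norm (f y))"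
proof -
  have "sphere (0::complex) k \<noteq> {}" using assms(2) by simp
  moreover have "continuous_on (sphere 0 k) (\<lambda>z. norm (f z))"
    by (rule continuous_on_norm[OF assms(1)])
  ultimately obtain z where z: "z \<in> sphere 0 k" "\<forall>y\<in>sphere 0 k. norm (f z) \<le> norm (f y)"
    using continuous_attains_inf[OF compact_sphere, of 0 k "\<lambda>z. norm (f z)"] by blast
  have "min_modulus f k = norm (f z)"
    unfolding min_modulus_def by (rule Least_equality) (use z in auto)
  then show ?thesis using z by blast
qed

end

theory Submission
  imports Defs "HOL-Computational_Algebra.Fundamental_Theorem_Algebra"
begin

text \<open>
  On the unit circle, the real part of \<open>z r'(z) / r(z)\<close> is a sum over the zeros \<open>b\<close> of \<open>p\<close> and the
  poles \<open>a\<close> of \<open>r\<close>. Each zero contributes at least \<open>1 / (1 + k)\<close>, each pole contributes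
  \<open>((\<bar>a\<bar>\<^sup>2 - 1) / \<bar>z - a\<bar>\<^sup>2 - 1) / 2\<close>, and the quantities \<open>(\<bar>a\<bar>\<^sup>2 - 1) / \<bar>z - a\<bar>\<^sup>2\<close> add up to \<open>\<bar>B'(z)\<bar>\<close>;
  this is the inequality without \<open>m\<close>. By the maximum principle on the exterior of the circle of
  radius \<open>k\<close>, adding a constant \<open>c\<close> with \<open>\<bar>c\<bar> < m\<close> to \<open>r\<close> keeps all zeros in the disc and leaves
  \<open>r'\<close> unchanged; align \<open>c\<close> with \<open>r(z)\<close> and let \<open>\<bar>c\<bar>\<close> tend to \<open>m\<close>.
\<close>

section \<open>Contributions of single zeros and poles on the unit circle\<close>

text \<open>Multiplying through by \<open>cnj (z - a)\<close> makes the real part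
  \<open>(1 - Re (z * cnj a)) / (norm (z - a))\<^sup>2\<close>, and expanding
  \<open>(norm (z - a))\<^sup>2\<close> eliminates \<open>Re (z * cnj a)\<close>. It serves zeros
  and poles alike.\<close>

lemma Re_unit_div_diff_eq:
  fixes z a :: complex
  assumes "norm z = 1" "z \<noteq> a"
  shows "Re (z / (z - a)) = (1 - ((norm a)\<^sup>2 - 1) / (norm (z - a))\<^sup>2) / 2"
proof -
  have zz: "(Re z)\<^sup>2 + (Im z)\<^sup>2 = 1"
    using assms(1) by (simp add: cmod_def real_sqrt_eq_1_iff)
  have pos: "0 < (norm (z - a))\<^sup>2" using assms(2) by simp
  have "Re (z / (z - a)) = (1 - Re (z * cnj a)) / (norm (z - a))\<^sup>2"
    using zz by (simp only: Re_divide cmod_power2) (simp add: algebra_simps power2_eq_square)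
  moreover have "2 * (1 - Re (z * cnj a)) = (norm (z - a))\<^sup>2 - ((norm a)\<^sup>2 - 1)"
    using zz by (simp only: cmod_power2) (simp add: algebra_simps power2_eq_square)
  ultimately show ?thesis using pos by (simp add: field_simps)
qed

text \<open>With \<open>s = norm b\<close> the numerator \<open>1 - s\<^sup>2\<close> is
  nonnegative, so the previous formula is smallest when \<open>norm (z - b)\<close> takes its
  largest possible value \<open>1 + s\<close>. This gives \<open>1 / (1 + s)\<close>, which
  decreases in \<open>s\<close>.\<close>

lemma Re_unit_div_diff_ge:
  fixes z b :: complex
  assumes "norm z = 1" "norm b \<le> k" "k \<le> 1" "z \<noteq> b"
  shows "1 / (1 + k) \<le> Re (z / (z - b))"
proof -
  define s where "s = norm b"
  have s: "0 \<le> s" "s \<le> k" "s \<le> 1" using assms by (auto simp: s_def)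
  have pos: "0 < (norm (z - b))\<^sup>2" using assms(4) by simp
  have "norm (z - b) \<le> 1 + s"
    using norm_triangle_ineq4[of z b] assms(1) by (simp add: s_def)
  then have "(norm (z - b))\<^sup>2 \<le> (1 + s)\<^sup>2"
    by (intro power_mono) auto
  then have "(1 - s\<^sup>2) / (1 + s)\<^sup>2 \<le> (1 - s\<^sup>2) / (norm (z - b))\<^sup>2"
    using s pos by (intro divide_left_mono) (auto simp: power_le_one)
  moreover have "(1 - s\<^sup>2) / (1 + s)\<^sup>2 = 2 / (1 + s) - 1"
    using s by (simp add: divide_simps) (simp add: power2_eq_square algebra_simps)
  moreover have "1 / (1 + k) \<le> 1 / (1 + s)"
    using s by (intro divide_left_mono) auto
  ultimately show ?thesis
    unfolding Re_unit_div_diff_eq[OF assms(1,4)] s_def by (simp add: diff_divide_distrib)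
qed

text \<open>Logarithmic derivatives turn products into sums: splitting off a linear factor adds
  \<open>z / (z - b)\<close>, which costs one unit of degree and contributes at least
  \<open>1 / (1 + k)\<close>.\<close>

lemma Re_logderiv_poly_ge:
  fixes p :: "complex poly"
  assumes "\<And>x. poly p x = 0 \<Longrightarrow> norm x \<le> k" "k \<le> 1" "norm z = 1" "poly p z \<noteq> 0"
  shows "real (degree p) / (1 + k) \<le> Re (z * poly (pderiv p) z / poly p z)"
  using assms(1,4)
proof (induction "degree p" arbitrary: p)
  case 0
  then obtain c where "p = [:c:]" by (metis degree_eq_zeroE)
  then show ?case by simp
next
  case (Suc d)
  have "degree p > 0" using Suc.hyps(2) by simp
  then obtain b where b: "poly p b = 0"
    using alg_closed_imp_poly_has_root[of p] by blast
  then obtain q where q: "p = [:- b, 1:] * q"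
    by (auto simp: poly_eq_0_iff_dvd elim: dvdE)
  have q0: "q \<noteq> 0" using Suc.prems(2) q by auto
  have deg: "degree p = Suc (degree q)"
    unfolding q using q0 by (subst degree_mult_eq) auto
  have nz: "poly q z \<noteq> 0" "z \<noteq> b" using Suc.prems(2) q by auto
  have IH: "real (degree q) / (1 + k) \<le> Re (z * poly (pderiv q) z / poly q z)"
    using Suc.hyps deg Suc.prems(1) nz q by auto
  have pz: "poly p z = (z - b) * poly q z"
    unfolding q by (simp add: algebra_simps)
  have dpz: "poly (pderiv p) z = poly q z + (z - b) * poly (pderiv q) z"
    unfolding q pderiv_mult poly_add poly_mult by (simp add: pderiv_pCons algebra_simps)
  have "z * poly (pderiv p) z / poly p z = z / (z - b) + z * poly (pderiv q) z / poly q z"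
    unfolding pz dpz using nz by (simp add: field_simps)
  moreover have "1 / (1 + k) \<le> Re (z / (z - b))"
    using Re_unit_div_diff_ge Suc.prems(1) b assms(2,3) nz by blast
  ultimately show ?case
    using IH deg by (simp add: add_divide_distrib)
qed

section \<open>Logarithmic derivatives of \<open>pole_prod\<close> and
  \<open>blaschke\<close>\<close>

lemma has_field_derivative_pole_prod:
  assumes "\<And>j. j \<in> {1..n} \<Longrightarrow> z \<noteq> a j"
  shows "(pole_prod a n has_field_derivative pole_prod a n z * (\<Sum>j=1..n. 1 / (z - a j))) (at z)"
  using assms
proof (induction n)
  case 0
  then show ?case by (simp add: pole_prod_def[abs_def])
next
  case (Suc n)
  have eq: "pole_prod a (Suc n) = (\<lambda>z. pole_prod a n z * (z - a (Suc n)))"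
    by (simp add: pole_prod_def fun_eq_iff)
  have "z \<noteq> a (Suc n)" using Suc.prems by auto
  moreover have "(pole_prod a n has_field_derivative pole_prod a n z * (\<Sum>j=1..n. 1 / (z - a j))) (at z)"
    using Suc by auto
  ultimately show ?case
    unfolding eq by (auto intro!: derivative_eq_intros simp: field_simps)
qed

lemma pole_prod_nonzero:
  assumes "\<And>j. j \<in> {1..n} \<Longrightarrow> z \<noteq> a j"
  shows "pole_prod a n z \<noteq> 0"
  using assms by (auto simp: pole_prod_def)

lemma norm_blaschke_factor:
  fixes z a :: complex
  assumes "norm z = 1" "z \<noteq> a"
  shows "norm ((1 - cnj a * z) / (z - a)) = 1"
proof -
  have "1 - cnj a * z = z * cnj (z - a)"
    using assms(1) complex_norm_square[of z] by (simp add: algebra_simps)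
  then have "norm (1 - cnj a * z) = norm (z - a)"
    using assms(1) by (metis complex_mod_cnj mult_1 norm_mult)
  then show ?thesis using assms(2) by (simp add: norm_divide)
qed

text \<open>The derivative is written as value times logarithmic derivative so that the latter add
  up over a product. On the unit circle \<open>cnj z\<close> is the inverse of \<open>z\<close>, and
  each logarithmic derivative is a real multiple of it.\<close>

lemma blaschke_factor_derivative:
  fixes z a :: complex
  assumes "norm z = 1" "z \<noteq> a"
  shows "((\<lambda>z. (1 - cnj a * z) / (z - a)) has_field_derivative
           (1 - cnj a * z) / (z - a) * (cnj z * of_real (((norm a)\<^sup>2 - 1) / (norm (z - a))\<^sup>2))) (at z)"
proof -
  have zz: "z * cnj z = 1"
    using assms(1) complex_norm_square[of z] by simp
  have nz: "z - a \<noteq> 0" "cnj z - cnj a \<noteq> 0"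
    using assms(2) by (auto simp flip: complex_cnj_diff)
  have f: "1 - cnj a * z = z * (cnj z - cnj a)"
    using zz by (simp add: algebra_simps)
  have "((\<lambda>z. (1 - cnj a * z) / (z - a)) has_field_derivative
          (a * cnj a - 1) / (z - a)\<^sup>2) (at z)"
    using nz by (auto intro!: derivative_eq_intros simp: power2_eq_square algebra_simps)
  moreover have "(1 - cnj a * z) / (z - a) * (cnj z * of_real (((norm a)\<^sup>2 - 1) / (norm (z - a))\<^sup>2))
      = (z * cnj z) * ((a * cnj a - 1) / (z - a)\<^sup>2)"
    unfolding f of_real_divide of_real_diff of_real_1 complex_norm_square complex_cnj_diff
    using nz by (simp add: power2_eq_square)
  ultimately show ?thesis by (simp add: zz)
qed

lemma norm_blaschke:
  assumes "norm z = 1" "\<And>j. j \<in> {1..n} \<Longrightarrow> z \<noteq> a j"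
  shows "norm (blaschke a n z) = 1"
  unfolding blaschke_def prod_norm[symmetric]
  using norm_blaschke_factor assms by (intro prod.neutral) auto

lemma has_field_derivative_blaschke:
  assumes "norm z = 1" "\<And>j. j \<in> {1..n} \<Longrightarrow> z \<noteq> a j"
  shows "(blaschke a n has_field_derivative
           blaschke a n z * (cnj z * of_real (\<Sum>j=1..n. ((norm (a j))\<^sup>2 - 1) / (norm (z - a j))\<^sup>2))) (at z)"
  using assms(2)
proof (induction n)
  case 0
  then show ?case by (simp add: blaschke_def[abs_def])
next
  case (Suc n)
  have eq: "blaschke a (Suc n) = (\<lambda>z. blaschke a n z * ((1 - cnj (a (Suc n)) * z) / (z - a (Suc n))))"
    by (simp add: blaschke_def fun_eq_iff)
  have IH: "(blaschke a n has_field_derivative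
           blaschke a n z * (cnj z * of_real (\<Sum>j=1..n. ((norm (a j))\<^sup>2 - 1) / (norm (z - a j))\<^sup>2))) (at z)"
    using Suc by auto
  have nz: "z \<noteq> a (Suc n)" using Suc.prems by auto
  show ?case
    unfolding eq
    by (rule DERIV_cong[OF DERIV_mult[OF IH blaschke_factor_derivative[OF assms(1) nz]]])
       (simp add: algebra_simps add_divide_distrib diff_divide_distrib)
qed

text \<open>All logarithmic derivatives of the factors are nonnegative multiples of the same unit
  vector \<open>cnj z\<close>, because \<open>norm (a j) > 1\<close>. Hence nothing cancels, and the
  modulus of the sum is the sum of the moduli.\<close>

lemma norm_deriv_blaschke:
  assumes "norm z = 1" "\<And>j. j \<in> {1..n} \<Longrightarrow> norm (a j) > 1"
  shows "norm (deriv (blaschke a n) z) = (\<Sum>j=1..n. ((norm (a j))\<^sup>2 - 1) / (norm (z - a j))\<^sup>2)"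
proof -
  have nz: "z \<noteq> a j" if "j \<in> {1..n}" for j
    using assms(1) assms(2)[OF that] by auto
  have "0 \<le> (\<Sum>j=1..n. ((norm (a j))\<^sup>2 - 1) / (norm (z - a j))\<^sup>2)"
  proof (rule sum_nonneg)
    fix j assume "j \<in> {1..n}"
    then have "1 \<le> (norm (a j))\<^sup>2"
      using assms(2) by (intro one_le_power) force
    then show "0 \<le> ((norm (a j))\<^sup>2 - 1) / (norm (z - a j))\<^sup>2" by simp
  qed
  moreover have "deriv (blaschke a n) z =
      blaschke a n z * (cnj z * of_real (\<Sum>j=1..n. ((norm (a j))\<^sup>2 - 1) / (norm (z - a j))\<^sup>2))"
    using has_field_derivative_blaschke[of z n a] assms(1) nz by (blast intro: DERIV_imp_deriv)
  moreover have "norm (blaschke a n z) = 1"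
    using norm_blaschke[of z n a] assms(1) nz by blast
  ultimately show ?thesis
    using assms(1) by (simp only: norm_mult norm_of_real complex_mod_cnj abs_of_nonneg mult_1)
qed

section \<open>The inequality without the minimum modulus\<close>

text \<open>Away from zeros of \<open>p\<close>, the derivative is the value times its logarithmic
  derivative \<open>?L\<close>, and \<open>norm ?L\<close> is at least \<open>Re (z * ?L)\<close>
  since \<open>norm z = 1\<close>. At a zero the left side is 0.\<close>

lemma norm_deriv_rational_ge:
  fixes p :: "complex poly"
  assumes k: "k \<le> 1"
    and a: "\<And>j. j \<in> {1..n} \<Longrightarrow> norm (a j) > 1"
    and deg: "degree p = n"
    and roots: "\<And>x. poly p x = 0 \<Longrightarrow> norm x \<le> k"
    and z: "norm z = 1"
  shows "1 / 2 * (norm (deriv (blaschke a n) z) + real n * (1 - k) / (1 + k))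
           * norm (poly p z / pole_prod a n z)
         \<le> norm (deriv (\<lambda>z. poly p z / pole_prod a n z) z)"
proof (cases "poly p z = 0")
  case True
  then show ?thesis by simp
next
  case False
  let ?r = "\<lambda>z. poly p z / pole_prod a n z"
  let ?C = "1 / 2 * (norm (deriv (blaschke a n) z) + real n * (1 - k) / (1 + k))"
  let ?L = "poly (pderiv p) z / poly p z - (\<Sum>j=1..n. 1 / (z - a j))"
  have nz: "z \<noteq> a j" if "j \<in> {1..n}" for j
    using z a[OF that] by auto
  then have w0: "pole_prod a n z \<noteq> 0"
      and dw: "(pole_prod a n has_field_derivative pole_prod a n z * (\<Sum>j=1..n. 1 / (z - a j))) (at z)"
    using pole_prod_nonzero has_field_derivative_pole_prod by blast+
  have "(?r has_field_derivative ?r z * ?L) (at z)"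
    by (rule DERIV_cong[OF DERIV_divide[OF poly_DERIV dw w0]])
       (use w0 False in \<open>simp_all add: field_simps\<close>)
  then have d: "deriv ?r z = ?r z * ?L"
    by (rule DERIV_imp_deriv)
  \<comment> \<open>For \<open>n = 0\<close> both sides are 0. Otherwise \<open>p\<close> has a
    root, which forces \<open>0 \<le> k\<close> and keeps \<open>1 + k\<close> away from 0.\<close>
  have "?C \<le> Re (z * ?L)"
  proof (cases "n = 0")
    case True
    then show ?thesis
      using deg z by (auto simp: blaschke_def[abs_def] elim!: degree_eq_zeroE)
  next
    case False
    then obtain b where "poly p b = 0"
      using alg_closed_imp_poly_has_root[of p] deg by auto
    then have k0: "0 \<le> k" using roots norm_ge_zero order_trans by blast
    have "z * ?L = z * poly (pderiv p) z / poly p z - (\<Sum>j=1..n. z / (z - a j))"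
      by (simp add: algebra_simps sum_distrib_left)
    then have "Re (z * ?L) = Re (z * poly (pderiv p) z / poly p z)
        - (\<Sum>j=1..n. (1 - ((norm (a j))\<^sup>2 - 1) / (norm (z - a j))\<^sup>2) / 2)"
      unfolding minus_complex.simps Re_sum
      using Re_unit_div_diff_eq[OF z nz] by (auto intro: sum.cong)
    also have "(\<Sum>j=1..n. (1 - ((norm (a j))\<^sup>2 - 1) / (norm (z - a j))\<^sup>2) / 2)
        = (real n - norm (deriv (blaschke a n) z)) / 2"
      using norm_deriv_blaschke[of z n a] z a
      by (simp only: sum_divide_distrib[symmetric] sum_subtractf) simp
    finally have "real n / (1 + k) - (real n - norm (deriv (blaschke a n) z)) / 2 \<le> Re (z * ?L)"
      using Re_logderiv_poly_ge[of p k z, OF roots k z \<open>poly p z \<noteq> 0\<close>] deg by simp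
    \<comment> \<open>This is where \<open>(1 - k) / (1 + k)\<close> arises: it equals
      \<open>2 / (1 + k) - 1\<close>.\<close>
    moreover have "?C = real n / (1 + k) - (real n - norm (deriv (blaschke a n) z)) / 2"
      using k0 by (simp add: divide_simps) (simp add: algebra_simps)
    ultimately show ?thesis by (simp only:)
  qed
  also have "\<dots> \<le> norm ?L"
    using complex_Re_le_cmod[of "z * ?L"] z by (simp add: norm_mult)
  finally have "?C * norm (?r z) \<le> norm ?L * norm (?r z)"
    by (rule mult_right_mono) simp
  then show ?thesis unfolding d norm_mult by (simp add: mult.commute)
qed

section \<open>Perturbing a polynomial without moving zeros out of the disc\<close>

text \<open>
  The maximum principle is applied to \<open>q(1 / \<zeta>) / p(1 / \<zeta>)\<close>, whose value at \<open>\<zeta> = 0\<close> is the quotient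
  of the leading coefficients.
\<close>

lemma poly_dominated_outside_circle:
  fixes p q :: "complex poly"
  assumes k: "0 < k" and deg: "degree q = degree p"
    and p0: "p \<noteq> 0"
    and roots: "\<And>x. poly p x = 0 \<Longrightarrow> norm x < k"
    and le: "\<And>x. norm x = k \<Longrightarrow> norm (poly q x) \<le> norm (poly p x)"
  shows "norm x \<ge> k \<Longrightarrow> norm (poly q x) \<le> norm (poly p x)"
    and "norm (lead_coeff q) \<le> norm (lead_coeff p)"
proof -
  let ?P = "reflect_poly p" and ?Q = "reflect_poly q"
  let ?D = "cball (0::complex) (1 / k)"
  let ?f = "\<lambda>y. poly ?Q y / poly ?P y"
  \<comment> \<open>Inversion carries \<open>?D\<close> to the exterior of the circle together with
    infinity; at \<open>y = 0\<close> the value of \<open>?P\<close> is the leading coefficient of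
    \<open>p\<close>.\<close>
  have P0: "poly ?P y \<noteq> 0" if "y \<in> ?D" for y
  proof (cases "y = 0")
    case True
    then show ?thesis using p0 by (simp add: poly_reflect_poly_0)
  next
    case False
    have "k \<le> norm (inverse y)"
      using that k False unfolding norm_inverse by (simp add: field_simps)
    then have "poly p (inverse y) \<noteq> 0" using roots by force
    then show ?thesis using False by (simp add: poly_reflect_poly_nz)
  qed
  have f: "norm (?f y) \<le> 1" if "y \<in> ?D" for y
  proof (rule maximum_modulus_frontier[where S = ?D and f = ?f])
    have "?f holomorphic_on ?D"
      using P0 by (intro holomorphic_intros) auto
    then show "?f holomorphic_on interior ?D" "continuous_on (closure ?D) ?f"
      using interior_subset holomorphic_on_subset
      by (blast, simp add: holomorphic_on_imp_continuous_on)
    fix x assume "x \<in> frontier ?D"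
    then have x: "norm x = 1 / k" using k by simp
    then have "x \<noteq> 0" "norm (inverse x) = k" using k by (auto simp: norm_inverse)
    \<comment> \<open>Since the degrees agree, the powers of \<open>x\<close> produced by the two
      reflections cancel in the quotient.\<close>
    then show "norm (?f x) \<le> 1"
      using le[of "inverse x"] by (auto simp: poly_reflect_poly_nz deg norm_divide divide_le_eq_1)
  qed (use that in auto)
  show "norm (lead_coeff q) \<le> norm (lead_coeff p)"
    using f[of 0] k p0 by (simp add: poly_reflect_poly_0 norm_divide divide_le_eq_1)
  assume x: "norm x \<ge> k"
  then have "x \<noteq> 0" using k by auto
  moreover have "poly p x \<noteq> 0" using roots x by force
  ultimately show "norm (poly q x) \<le> norm (poly p x)"
    using f[of "inverse x"] k x
    by (simp add: poly_reflect_poly_nz deg norm_divide norm_inverse divide_le_eq_1 field_simps)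
qed

text \<open>Outside the open disc \<open>c * q\<close> is strictly smaller than \<open>p\<close> in
  modulus, so the sum cannot vanish there. The same comparison at infinity, between leading
  coefficients, preserves the degree.\<close>

lemma roots_add_dominated:
  fixes p q :: "complex poly"
  assumes k: "0 < k" and deg: "degree q = degree p"
    and p0: "p \<noteq> 0"
    and roots: "\<And>x. poly p x = 0 \<Longrightarrow> norm x < k"
    and le: "\<And>x. norm x = k \<Longrightarrow> norm (poly q x) \<le> norm (poly p x)"
    and c: "norm c < 1"
  shows "degree (p + smult c q) = degree p"
    and "poly (p + smult c q) x = 0 \<Longrightarrow> norm x < k"
proof -
  note dom = poly_dominated_outside_circle[OF k deg p0 roots le]
  have nz: "u + c * v \<noteq> 0" if "norm v \<le> norm u" "u \<noteq> 0" for u v :: complex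
  proof
    assume "u + c * v = 0"
    then have "norm u = norm c * norm v"
      by (metis add_eq_0_iff norm_minus_cancel norm_mult)
    also have "\<dots> \<le> norm c * norm u"
      using that by (intro mult_left_mono) auto
    also have "\<dots> < norm u" using c that by simp
    finally show False by simp
  qed
  have "coeff (p + smult c q) (degree p) \<noteq> 0"
    using nz[OF dom(2)] p0 deg by simp
  moreover have "degree (p + smult c q) \<le> degree p"
    using deg by (intro degree_add_le) (auto intro: order_trans[OF degree_smult_le])
  ultimately show "degree (p + smult c q) = degree p"
    by (metis le_degree antisym)
  assume "poly (p + smult c q) x = 0"
  then show "norm x < k"
    using nz[OF dom(1)] roots by (force simp: not_less[symmetric])
qed

section \<open>The inequality with the minimum modulus\<close>

lemma norm_deriv_rational_ge_min_modulus:
  fixes p :: "complex poly"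
  assumes k: "0 < k" "k \<le> 1"
    and a: "\<And>j. j \<in> {1..n} \<Longrightarrow> norm (a j) > 1"
    and deg: "degree p = n"
    and roots: "\<And>x. poly p x = 0 \<Longrightarrow> norm x \<le> k"
    and z: "norm z = 1"
  shows "1 / 2 * (norm (deriv (blaschke a n) z) + real n * (1 - k) / (1 + k))
           * (norm (poly p z / pole_prod a n z) + min_modulus (\<lambda>z. poly p z / pole_prod a n z) k)
         \<le> norm (deriv (\<lambda>z. poly p z / pole_prod a n z) z)"
proof -
  let ?r = "\<lambda>z. poly p z / pole_prod a n z"
  let ?C = "1 / 2 * (norm (deriv (blaschke a n) z) + real n * (1 - k) / (1 + k))"
  define m where "m = min_modulus ?r k"
  define W where "W = (\<Prod>j=1..n. [:- a j, 1:])"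
  have W: "poly W x = pole_prod a n x" for x
    by (simp add: W_def pole_prod_def poly_prod)
  have degW: "degree W = n"
    unfolding W_def by (subst degree_prod_eq_sum_degree) auto
  have w0: "pole_prod a n x \<noteq> 0" if "norm x \<le> 1" for x
  proof (rule pole_prod_nonzero)
    show "x \<noteq> a j" if "j \<in> {1..n}" for j
      using a[OF that] \<open>norm x \<le> 1\<close> by auto
  qed
  have "continuous_on (sphere 0 k) ?r"
    unfolding W[symmetric] using w0 k by (intro continuous_intros) (auto simp: W)
  then obtain y where y: "norm y = k" "m = norm (?r y)"
      and min: "\<And>x. norm x = k \<Longrightarrow> m \<le> norm (?r x)"
    using min_modulus_attained[of k ?r] k unfolding m_def by fastforce
  have "poly s field_differentiable at z" for s
    unfolding field_differentiable_def using poly_DERIV[of s z] by blast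
  from field_differentiable_divide[OF this[of p] this[of W]]
  have rdiff: "?r field_differentiable at z"
    using w0[of z] z by (simp add: W)
  note base = norm_deriv_rational_ge[where k = k and n = n and a = a and z = z, OF k(2) a _ _ z]
  \<comment> \<open>If \<open>m = 0\<close>, the earlier inequality suffices. If
    \<open>m > 0\<close>, no zero of \<open>p\<close> lies on the circle of radius \<open>k\<close>,
    so all zeros are strictly inside, and \<open>smult (of_real m) W\<close> has the full degree
    \<open>n\<close>, as the perturbation requires.\<close>
  show ?thesis
  proof (cases "m = 0")
    case True
    then show ?thesis
      using base[of p, OF _ deg roots] by (simp add: m_def)
  next
    case False
    then have m: "m > 0" using y(2) by simp
    have p0: "p \<noteq> 0" using False y by auto
    have p_roots: "norm x < k" if "poly p x = 0" for x
      using roots[OF that] min[of x] m that by (cases "norm x = k") auto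
    have C: "?C * (norm (?r z) + t * m) \<le> norm (deriv ?r z)" if t: "0 < t" "t < 1" for t
    proof -
      \<comment> \<open>The direction of the value at \<open>z\<close>: adding
        \<open>t * m * u\<close> then increases the modulus by exactly \<open>t * m\<close>. At a
        zero any unit vector would do.\<close>
      define u where "u = (if ?r z = 0 then 1 else sgn (?r z))"
      have u: "norm u = 1" "?r z = of_real (norm (?r z)) * u"
        unfolding u_def sgn_eq by (simp_all only: norm_divide norm_of_real abs_norm_cancel split: if_split) auto
      define c where "c = of_real t * u"
      have c: "norm c < 1" using t u by (simp add: c_def norm_mult)
      \<comment> \<open>Adding a constant to the quotient means adding a multiple of
        \<open>W\<close> to \<open>p\<close>. On the circle of radius \<open>k\<close>,
        \<open>m * W\<close> is dominated by \<open>p\<close> by the choice of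
        \<open>m\<close>.\<close>
      define q where "q = p + smult c (smult (of_real m) W)"
      have q: "degree q = degree p" "\<And>x. poly q x = 0 \<Longrightarrow> norm x < k"
        unfolding q_def
      proof -
        have dom: "norm (poly (smult (of_real m) W) x) \<le> norm (poly p x)" if "norm x = k" for x
          using min[OF that] w0[of x] that k m by (simp add: W norm_mult norm_divide field_simps)
        have "degree (smult (of_real m) W) = degree p" using m deg degW by simp
        note * = roots_add_dominated[of k "smult (of_real m) W" p c, OF k(1) this p0 _ _ c]
        show "degree (p + smult c (smult (of_real m) W)) = degree p"
          using *(1) p_roots dom by blast
        show "norm x < k" if "poly (p + smult c (smult (of_real m) W)) x = 0" for x
          using *(2) p_roots dom that by blast
      qed
      have rq: "poly q x / pole_prod a n x = ?r x + c * of_real m" if "pole_prod a n x \<noteq> 0" for x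
        using that by (simp add: q_def W field_simps)
      \<comment> \<open>\<open>rq\<close> can fail at the poles, where both quotients are 0 by
        convention, so the derivatives are compared through equality near \<open>z\<close>
        only.\<close>
      have "open {x. pole_prod a n x \<noteq> 0}"
        unfolding W[symmetric] by (intro open_Collect_neq continuous_intros)
      from eventually_nhds_in_open[OF this, of z]
      have "eventually (\<lambda>x. pole_prod a n x \<noteq> 0) (nhds z)"
        using w0[of z] z by simp
      then have "deriv (\<lambda>x. poly q x / pole_prod a n x) z = deriv (\<lambda>x. ?r x + c * of_real m) z"
        by (intro deriv_cong_ev) (auto elim!: eventually_mono simp: rq)
      also have "\<dots> = deriv ?r z"
        using rdiff by (subst deriv_add) auto
      finally have D: "deriv (\<lambda>x. poly q x / pole_prod a n x) z = deriv ?r z" .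
      have "poly q z / pole_prod a n z = of_real (norm (?r z) + t * m) * u"
        using rq[OF w0[of z]] z u(2) by (simp add: c_def algebra_simps)
      then have "norm (poly q z / pole_prod a n z) = norm (?r z) + t * m"
        using u(1) t m by (simp only: norm_mult norm_of_real) simp
      then show ?thesis
        using base[of q] q deg D by (fastforce intro: less_imp_le)
    qed
    define K where "K = ?C"
    \<comment> \<open>This is the limit \<open>t\<close> to 1: the bound for all \<open>t\<close>
      strictly between 0 and 1 gives it for \<open>t = 1\<close>.\<close>
    have "K * m \<le> norm (deriv ?r z) - K * norm (?r z)"
      by (rule field_le_mult_one_interval) (use C[folded K_def] in \<open>simp add: algebra_simps\<close>)
    then show ?thesis
      unfolding m_def[symmetric] K_def[symmetric] by (simp add: algebra_simps)
  qed
qed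

section \<open>The extremal function\<close>

lemma min_modulus_eq_0:
  assumes "norm x = k" "f x = 0"
  shows "min_modulus f k = 0"
  unfolding min_modulus_def
  by (rule Least_equality) (use assms in \<open>auto simp: image_iff intro!: bexI[of _ x]\<close>)

text \<open>For \<open>n > 0\<close> the zero \<open>- k\<close> lies on the circle of radius
  \<open>k\<close>, so the minimum modulus is 0. Both sides then reduce to \<open>norm (r 1)\<close>
  times \<open>n * s\<close>.\<close>

lemma extremal_equality:
  fixes k \<alpha> :: real and n :: nat
  assumes k: "0 < k" and \<alpha>: "\<alpha> > 1"
  defines "r \<equiv> (\<lambda>z. ((z + of_real k) / (z - of_real \<alpha>)) ^ n :: complex)"
  shows "norm (deriv r 1) =
     1 / 2 * (norm (deriv (blaschke (\<lambda>_. of_real \<alpha>) n) 1) + real n * (1 - k) / (1 + k))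
       * (norm (r 1) + min_modulus r k)"
proof (cases "n = 0")
  case True
  \<comment> \<open>Here \<open>r\<close> is constantly 1 and its minimum modulus is not 0, but both
    derivatives vanish, and so do both sides.\<close>
  then show ?thesis by (simp add: r_def blaschke_def[abs_def])
next
  case False
  then have m: "min_modulus r k = 0"
    using k by (intro min_modulus_eq_0[of "- of_real k"]) (auto simp: r_def)
  have nz: "(1::complex) - of_real \<alpha> \<noteq> 0" "(1::complex) + of_real k \<noteq> 0"
    using k \<alpha> by (auto simp: complex_eq_iff)
  \<comment> \<open>The logarithmic derivative of \<open>(z + k) / (z - \<alpha>)\<close> at 1,
    namely \<open>1 / (1 + k) + 1 / (\<alpha> - 1)\<close>.\<close>
  define s :: real where "s = (\<alpha> + k) / ((\<alpha> - 1) * (1 + k))"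
  have s: "s \<ge> 0" using k \<alpha> by (simp add: s_def)
  have sc: "of_real s = (of_real \<alpha> + of_real k) / ((of_real \<alpha> - 1) * (1 + of_real k) :: complex)"
    by (simp add: s_def)
  have h: "((\<lambda>z. (z + of_real k) / (z - of_real \<alpha>)) has_field_derivative
      (1 + of_real k) / (1 - of_real \<alpha>) * of_real s) (at (1::complex))"
    using nz unfolding sc
    by (auto intro!: derivative_eq_intros simp: divide_simps) (auto simp: algebra_simps)
  have "(r has_field_derivative r 1 * of_real (real n * s)) (at 1)"
    unfolding r_def
    by (rule DERIV_cong[OF DERIV_power[OF h, of n]])
       (use False in \<open>simp add: power_eq_if[of _ n] mult_ac\<close>)
  then have "deriv r 1 = r 1 * of_real (real n * s)"
    by (rule DERIV_imp_deriv)
  then have d: "norm (deriv r 1) = norm (r 1) * (real n * s)"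
    using s by (simp add: norm_mult)
  have B: "norm (deriv (blaschke (\<lambda>_. of_real \<alpha>) n) 1) = real n * ((\<alpha> + 1) / (\<alpha> - 1))"
  proof -
    have "norm (1 - complex_of_real \<alpha>) = \<alpha> - 1"
      using \<alpha> by (metis abs_of_neg diff_less_0_iff_less minus_diff_eq norm_of_real of_real_1 of_real_diff)
    then have "norm (deriv (blaschke (\<lambda>_. of_real \<alpha>) n) 1) = real n * ((\<alpha>\<^sup>2 - 1) / (\<alpha> - 1)\<^sup>2)"
      using \<alpha> by (subst norm_deriv_blaschke) auto
    also have "(\<alpha>\<^sup>2 - 1) / (\<alpha> - 1)\<^sup>2 = (\<alpha> + 1) / (\<alpha> - 1)"
      using \<alpha> by (simp add: divide_simps) (simp add: power2_eq_square algebra_simps)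
    finally show ?thesis .
  qed
  have s_eq: "s = 1 / 2 * ((\<alpha> + 1) / (\<alpha> - 1) + (1 - k) / (1 + k))"
    using k \<alpha> by (simp add: s_def divide_simps) (simp add: algebra_simps)
  show ?thesis
    unfolding d B m s_eq times_divide_eq_right[of "real n" "1 - k", symmetric]
    by (simp only: add_0_right) (simp only: algebra_simps)
qed

theorem corollary1p4:
  fixes n :: nat and k :: real
  assumes "0 < k" and "k \<le> 1"
  shows
    "(\<forall>(a :: nat \<Rightarrow> complex) (p :: complex poly) (r :: complex \<Rightarrow> complex).
        (\<forall>j\<in>{1..n}. norm (a j) > 1) \<longrightarrow>
        r \<in> rational_space a n \<longrightarrow>
        r = (\<lambda>z. poly p z / pole_prod a n z) \<longrightarrow>
        degree p = n \<longrightarrow>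
        (\<forall>z. poly p z = 0 \<longrightarrow> norm z \<le> k) \<longrightarrow>
        (\<forall>z. norm z = 1 \<longrightarrow>
          norm (deriv r z) \<ge>
            1 / 2 * (norm (deriv (blaschke a n) z) + real n * (1 - k) / (1 + k))
                  * (norm (r z) + min_modulus r k)))
     \<and>
     (\<forall>\<alpha>::real. \<alpha> > 1 \<longrightarrow>
        (let a = (\<lambda>j::nat. complex_of_real \<alpha>);
             p = [:complex_of_real k, 1:] ^ n;
             r = (\<lambda>z. ((z + complex_of_real k) / (z - complex_of_real \<alpha>)) ^ n);
             B = (\<lambda>z. ((1 - complex_of_real \<alpha> * z) / (z - complex_of_real \<alpha>)) ^ n)
         in r \<in> rational_space a n \<and>
            r = (\<lambda>z. poly p z / pole_prod a n z) \<and>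
            degree p = n \<and>
            (\<forall>z. poly p z = 0 \<longrightarrow> norm z \<le> k) \<and>
            B = blaschke a n \<and>
            norm (deriv r 1) =
              1 / 2 * (norm (deriv B 1) + real n * (1 - k) / (1 + k))
                    * (norm (r 1) + min_modulus r k)))"
proof (intro conjI allI impI)
  fix a :: "nat \<Rightarrow> complex" and p :: "complex poly" and r :: "complex \<Rightarrow> complex" and z :: complex
  assume "\<forall>j\<in>{1..n}. norm (a j) > 1" "r = (\<lambda>z. poly p z / pole_prod a n z)" "degree p = n"
    "\<forall>z. poly p z = 0 \<longrightarrow> norm z \<le> k" "norm z = 1"
  then show "norm (deriv r z) \<ge>
      1 / 2 * (norm (deriv (blaschke a n) z) + real n * (1 - k) / (1 + k))
            * (norm (r z) + min_modulus r k)"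
    using norm_deriv_rational_ge_min_modulus[OF assms, of n a p z] by simp
next
  fix \<alpha> :: real
  assume \<alpha>: "\<alpha> > 1"
  let ?a = "\<lambda>j::nat. complex_of_real \<alpha>"
  let ?p = "[:complex_of_real k, 1:] ^ n"
  let ?r = "\<lambda>z. ((z + complex_of_real k) / (z - complex_of_real \<alpha>)) ^ n"
  let ?B = "\<lambda>z. ((1 - complex_of_real \<alpha> * z) / (z - complex_of_real \<alpha>)) ^ n"
  \<comment> \<open>The identity includes \<open>z = \<alpha>\<close>: for \<open>n > 0\<close> both
    sides are 0 there by the division convention.\<close>
  have r: "?r = (\<lambda>z. poly ?p z / pole_prod ?a n z)"
    by (simp add: fun_eq_iff pole_prod_def power_divide add.commute)
  have deg: "degree ?p = n"
    by (simp add: degree_power_eq)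
  have "?r \<in> rational_space ?a n"
    unfolding rational_space_def mem_Collect_eq
    by (rule exI[of _ ?p], rule conjI[OF r]) (simp add: deg)
  moreover have "norm z \<le> k" if "poly ?p z = 0" for z
  proof -
    have "z = - of_real k"
      using that by (auto simp: add_eq_0_iff)
    then show ?thesis using assms by simp
  qed
  moreover have B: "?B = blaschke ?a n"
    by (simp add: fun_eq_iff blaschke_def)
  ultimately show "let a = ?a; p = ?p; r = ?r; B = ?B
         in r \<in> rational_space a n \<and>
            r = (\<lambda>z. poly p z / pole_prod a n z) \<and>
            degree p = n \<and>
            (\<forall>z. poly p z = 0 \<longrightarrow> norm z \<le> k) \<and>
            B = blaschke a n \<and>
            norm (deriv r 1) =
              1 / 2 * (norm (deriv B 1) + real n * (1 - k) / (1 + k))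
                    * (norm (r 1) + min_modulus r k)"
    using r deg extremal_equality[OF assms(1) \<alpha>, of n] unfolding Let_def B by blast
qed

end
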